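(* Let $H$ be a Hopf algebra, regarded with the trivial $\mathbb{Z}^n$-grading, and let $A=\bigoplus_{r\in\mathbb{Z}^n}A_r$ be a right $H$-comodule algebra with coaction $\delta^A:A\to A\otimes H$, which is $\mathbb{Z}^n$-graded in such a way that the multiplication $m$ preserves the grading, $m(A_r\otimes A_l)\subset A_{r+l}$, and $\delta^A(A_r)\subset A_r\otimes H$ for all $r,l\in\mathbb{Z}^n$. Let $\theta$ be a real skew-symmetric $n\times n$ matrix and let $A_\theta=(A,m_\theta)$ be the $\theta$-deformation of $A$. Then: (1) $A_\theta$ is an $H$-comodule algebra with the same coaction, treated as a map $\delta^A:A_\theta\to A_\theta\otimes H$. (2) The coinvariant subspace $B=A^{\mathrm{co}H}$ remains the same, and the multiplication $m_\theta$ restricts to $B$, giving a (sub)algebra $B_\theta=(B,m_\theta)$. (3) If $B\subseteq A$ is an $H$-Hopf--Galois extension (with algebra of coinvariant elements $B$), then so is its deformation $B_\theta\subseteq A_\theta$: it is an $H$-Hopf--Galois extension with algebra of coinvariant elements $B_\theta$.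
   Context: All algebras are unital associative over $\mathbb{C}$ and $\otimes=\otimes_{\mathbb{C}}$. The deformed multiplication is defined on homogeneous elements by $m_\theta(a_r,\tilde a_l)=\lambda_\theta(r,l)\,m(a_r,\tilde a_l)$ for $a_r\in A_r$, $\tilde a_l\in A_l$, extended bilinearly, where $\lambda_\theta(r,l)=e^{\pi i\langle\theta r,l\rangle}$ for $r,l\in\mathbb{Z}^n$ and $\langle\cdot,\cdot\rangle$ is the standard pairing. Write $\delta^A(a)=a_{(0)}\otimes a_{(1)}$. The coinvariant subalgebra is $A^{\mathrm{co}H}=\{b\in A:\delta^A(b)=b\otimes 1_H\}$. An extension $B=A^{\mathrm{co}H}\subseteq A$ is an $H$-Hopf--Galois extension if the canonical Galois map $\chi:A\otimes_BA\to A\otimes H$, $\tilde a\otimes_Ba\mapsto\tilde a\,a_{(0)}\otimes a_{(1)}$, is an isomorphism (for $A_\theta$, the product $\tilde a\,a_{(0)}$ is replaced by $m_\theta(\tilde a,a_{(0)})$ and $\otimes_B$ by $\otimes_{B_\theta}$). *)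

theory Defs
  imports "HOL-Analysis.Analysis" "HOL-Library.Poly_Mapping"
begin

section \<open>Complex vector spaces\<close>

class complex_vector = ab_group_add +
  fixes scaleC :: "complex \<Rightarrow> 'a \<Rightarrow> 'a"  (infixr \<open>*\<^sub>C\<close> 75)
  assumes scaleC_add_right: "c *\<^sub>C (x + y) = c *\<^sub>C x + c *\<^sub>C y"
    and scaleC_add_left: "(c + d) *\<^sub>C x = c *\<^sub>C x + d *\<^sub>C x"
    and scaleC_scaleC: "c *\<^sub>C (d *\<^sub>C x) = (c * d) *\<^sub>C x"
    and scaleC_one: "1 *\<^sub>C x = x"

interpretation cv: vector_space "scaleC :: complex \<Rightarrow> 'a \<Rightarrow> 'a::complex_vector"
  by standard (simp_all add: scaleC_add_right scaleC_add_left scaleC_scaleC scaleC_one)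

abbreviation clinear :: "('a::complex_vector \<Rightarrow> 'b::complex_vector) \<Rightarrow> bool"
  where "clinear \<equiv> Vector_Spaces.linear scaleC scaleC"

lemma clinear_iff:
  "clinear f \<longleftrightarrow> (\<forall>x y. f (x + y) = f x + f y) \<and> (\<forall>c x. f (c *\<^sub>C x) = c *\<^sub>C f x)"
  by (simp add: Vector_Spaces.linear_iff cv.vector_space_axioms)

definition cbilinear :: "('a::complex_vector \<Rightarrow> 'b::complex_vector \<Rightarrow> 'c::complex_vector) \<Rightarrow> bool"
  where "cbilinear f \<longleftrightarrow> (\<forall>x. clinear (\<lambda>y. f x y)) \<and> (\<forall>y. clinear (\<lambda>x. f x y))"

instantiation complex :: complex_vector
begin
definition scaleC_complex :: "complex \<Rightarrow> complex \<Rightarrow> complex"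
  where "scaleC_complex c z = c * z"
instance
  by standard (simp_all add: scaleC_complex_def algebra_simps)
end

instantiation poly_mapping :: (type, complex_vector) complex_vector
begin
lift_definition scaleC_poly_mapping :: "complex \<Rightarrow> ('a \<Rightarrow>\<^sub>0 'b) \<Rightarrow> ('a \<Rightarrow>\<^sub>0 'b)"
  is "\<lambda>c f k. c *\<^sub>C f k"
  by (erule finite_subset[rotated]) auto
instance
  by standard (transfer; simp add: fun_eq_iff cv.scale_right_distrib cv.scale_left_distrib)+
end


section \<open>Algebraic tensor products over the complex numbers\<close>

text \<open>The tensor product is the free vector space on the set of pairs, modulo the subspace
  generated by the relations of bilinearity.\<close>

definition tensor_relators :: "('a::complex_vector \<times> 'b::complex_vector \<Rightarrow>\<^sub>0 complex) set"
  where "tensor_relators =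
    (let e = (\<lambda>x y. Poly_Mapping.single (x, y) 1) in
      {e (x + x') y - e x y - e x' y | x x' y. True} \<union>
      {e x (y + y') - e x y - e x y' | x y y'. True} \<union>
      {e (c *\<^sub>C x) y - c *\<^sub>C e x y | c x y. True} \<union>
      {e x (c *\<^sub>C y) - c *\<^sub>C e x y | c x y. True})"

definition tensor_rel ::
    "('a::complex_vector \<times> 'b::complex_vector \<Rightarrow>\<^sub>0 complex) \<Rightarrow> ('a \<times> 'b \<Rightarrow>\<^sub>0 complex) \<Rightarrow> bool"
  where "tensor_rel p q \<longleftrightarrow> p - q \<in> cv.span tensor_relators"

lemma equivp_tensor_rel: "equivp tensor_rel"
proof (rule equivpI)
  show "reflp tensor_rel"
    by (simp add: reflp_def tensor_rel_def cv.span_zero)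
  show "symp tensor_rel"
    unfolding symp_def tensor_rel_def by (metis cv.span_neg minus_diff_eq)
  show "transp tensor_rel"
    unfolding transp_def tensor_rel_def
    by (metis (no_types, lifting) cv.span_add diff_add_cancel add_diff_eq)
qed

quotient_type (overloaded) ('a, 'b) tensor = "('a::complex_vector \<times> 'b::complex_vector) \<Rightarrow>\<^sub>0 complex"
  / tensor_rel
  by (rule equivp_tensor_rel)

instantiation tensor :: (complex_vector, complex_vector) complex_vector
begin

lift_definition zero_tensor :: "('a, 'b) tensor" is 0 .

lift_definition plus_tensor :: "('a, 'b) tensor \<Rightarrow> ('a, 'b) tensor \<Rightarrow> ('a, 'b) tensor" is "(+)"
  unfolding tensor_rel_def by (metis add_diff_add cv.span_add)

lift_definition minus_tensor :: "('a, 'b) tensor \<Rightarrow> ('a, 'b) tensor \<Rightarrow> ('a, 'b) tensor" is "(-)"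
proof -
  fix p p' q q' :: "('a \<times> 'b) \<Rightarrow>\<^sub>0 complex"
  assume "tensor_rel p p'" "tensor_rel q q'"
  moreover have "(p - q) - (p' - q') = (p - p') - (q - q')" by simp
  ultimately show "tensor_rel (p - q) (p' - q')"
    unfolding tensor_rel_def by (metis cv.span_diff)
qed

lift_definition uminus_tensor :: "('a, 'b) tensor \<Rightarrow> ('a, 'b) tensor" is uminus
  unfolding tensor_rel_def by (metis cv.span_neg minus_diff_minus)

lift_definition scaleC_tensor :: "complex \<Rightarrow> ('a, 'b) tensor \<Rightarrow> ('a, 'b) tensor" is scaleC
  unfolding tensor_rel_def by (metis cv.scale_right_diff_distrib cv.span_scale)

lemma tensor_relI: "p = q \<Longrightarrow> tensor_rel p q"
  by (simp add: tensor_rel_def cv.span_zero)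

instance
  by standard
    (transfer; rule tensor_relI; simp add: cv.scale_right_distrib cv.scale_left_distrib)+

end

lift_definition pure_tensor :: "'a::complex_vector \<Rightarrow> 'b::complex_vector \<Rightarrow> ('a, 'b) tensor"
  (infixr \<open>\<otimes>\<close> 76) is "\<lambda>x y. Poly_Mapping.single (x, y) 1" .

lemma pure_tensor_simps:
  fixes x x' :: "'a::complex_vector" and y y' :: "'b::complex_vector"
  shows "(x + x') \<otimes> y = x \<otimes> y + x' \<otimes> y"
    and "x \<otimes> (y + y') = x \<otimes> y + x \<otimes> y'"
    and "(c *\<^sub>C x) \<otimes> y = c *\<^sub>C (x \<otimes> y)"
    and "x \<otimes> (c *\<^sub>C y) = c *\<^sub>C (x \<otimes> y)"
proof -
  have rel: "tensor_rel p q" if "p - q \<in> tensor_relators" for p q :: "'a \<times> 'b \<Rightarrow>\<^sub>0 complex"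
    using that by (simp add: tensor_rel_def cv.span_base)
  show "(x + x') \<otimes> y = x \<otimes> y + x' \<otimes> y"
    by (transfer, rule rel, unfold tensor_relators_def Let_def diff_diff_eq) blast
  show "x \<otimes> (y + y') = x \<otimes> y + x \<otimes> y'"
    by (transfer, rule rel, unfold tensor_relators_def Let_def diff_diff_eq) blast
  show "(c *\<^sub>C x) \<otimes> y = c *\<^sub>C (x \<otimes> y)"
    by (transfer, rule rel, unfold tensor_relators_def Let_def) blast
  show "x \<otimes> (c *\<^sub>C y) = c *\<^sub>C (x \<otimes> y)"
    by (transfer, rule rel, unfold tensor_relators_def Let_def) blast
qed

lemma cbilinear_pure_tensor: "cbilinear (\<otimes>)"
  by (simp add: cbilinear_def clinear_iff pure_tensor_simps)

lemma tensor_sum_pure: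
  "\<exists>p :: 'a \<times> 'b \<Rightarrow>\<^sub>0 complex. t =
    (\<Sum>k\<in>Poly_Mapping.keys p. Poly_Mapping.lookup p k *\<^sub>C (fst k \<otimes> snd k))"
  for t :: "('a::complex_vector, 'b::complex_vector) tensor"
proof -
  have add: "abs_tensor (p + q) = abs_tensor p + abs_tensor q" for p q :: "'a \<times> 'b \<Rightarrow>\<^sub>0 complex"
    by (simp add: plus_tensor.abs_eq)
  have sum: "abs_tensor (sum g S) = (\<Sum>k\<in>S. abs_tensor (g k))"
    for g :: "'a \<times> 'b \<Rightarrow> ('a \<times> 'b \<Rightarrow>\<^sub>0 complex)" and S
    by (induction S rule: infinite_finite_induct)
      (simp_all add: add zero_tensor.abs_eq)
  obtain p where t: "t = abs_tensor p"
    by (metis Quotient3_abs_rep Quotient3_tensor)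
  have scale: "Poly_Mapping.single k c = c *\<^sub>C Poly_Mapping.single k (1::complex)"
    for k :: "'a \<times> 'b" and c
    by (rule poly_mapping_eqI)
      (simp add: scaleC_poly_mapping.rep_eq lookup_single when_def scaleC_complex_def)
  have "p = (\<Sum>k\<in>Poly_Mapping.keys p. Poly_Mapping.single k (Poly_Mapping.lookup p k))"
    by (rule poly_mapping_eqI)
      (simp add: lookup_sum lookup_single when_def in_keys_iff sum.delta)
  also have "abs_tensor \<dots> =
      (\<Sum>k\<in>Poly_Mapping.keys p. Poly_Mapping.lookup p k *\<^sub>C (fst k \<otimes> snd k))"
    unfolding sum
    by (intro sum.cong refl, subst scale)
      (simp add: scaleC_tensor.abs_eq[symmetric] pure_tensor.abs_eq)
  finally show ?thesis
    using t by blast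
qed

lemma span_pure_tensors:
  "cv.span {x \<otimes> y | x y. True} = (UNIV :: ('a::complex_vector, 'b::complex_vector) tensor set)"
proof -
  have "t \<in> cv.span {x \<otimes> y | x y. True}" for t :: "('a, 'b) tensor"
  proof -
    obtain p :: "'a \<times> 'b \<Rightarrow>\<^sub>0 complex" where
      "t = (\<Sum>k\<in>Poly_Mapping.keys p. Poly_Mapping.lookup p k *\<^sub>C (fst k \<otimes> snd k))"
      using tensor_sum_pure by blast
    moreover have "fst k \<otimes> snd k \<in> cv.span {x \<otimes> y | x y. True}" for k :: "'a \<times> 'b"
      by (rule cv.span_base) blast
    ultimately show ?thesis
      by (auto intro!: cv.span_sum cv.span_scale)
  qed
  then show ?thesis by blast
qed

lemma tensor_ext:
  fixes f g :: "('a::complex_vector, 'b::complex_vector) tensor \<Rightarrow> 'c::complex_vector"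
  assumes "clinear f" "clinear g" "\<And>x y. f (x \<otimes> y) = g (x \<otimes> y)"
  shows "f t = g t"
proof -
  interpret vector_space_pair
    "scaleC :: complex \<Rightarrow> ('a, 'b) tensor \<Rightarrow> _" "scaleC :: complex \<Rightarrow> 'c \<Rightarrow> _"
    by standard
  show ?thesis
    by (rule linear_eq_on[OF assms(1,2), of t "{x \<otimes> y | x y. True}"])
      (use assms(3) span_pure_tensors in auto)
qed

definition tensor_lift ::
    "('a::complex_vector \<Rightarrow> 'b::complex_vector \<Rightarrow> 'c::complex_vector) \<Rightarrow> ('a, 'b) tensor \<Rightarrow> 'c"
  where "tensor_lift f = (THE g. clinear g \<and> (\<forall>x y. g (x \<otimes> y) = f x y))"

text \<open>The universal property of the tensor product.\<close>

lemma ex1_tensor_lift: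
  fixes f :: "'a::complex_vector \<Rightarrow> 'b::complex_vector \<Rightarrow> 'c::complex_vector"
  assumes "cbilinear f"
  shows "\<exists>!g. clinear g \<and> (\<forall>x y. g (x \<otimes> y) = f x y)"
proof -
  define F where "F p = (\<Sum>k\<in>Poly_Mapping.keys p. Poly_Mapping.lookup p k *\<^sub>C f (fst k) (snd k))"
    for p :: "'a \<times> 'b \<Rightarrow>\<^sub>0 complex"
  have F_eq: "F p = (\<Sum>k\<in>S. Poly_Mapping.lookup p k *\<^sub>C f (fst k) (snd k))"
    if "finite S" "Poly_Mapping.keys p \<subseteq> S" for p S
    unfolding F_def using that
    by (intro sum.mono_neutral_left) (auto simp: in_keys_iff)
  have F_add: "F (p + q) = F p + F q" for p q
  proof -
    let ?S = "Poly_Mapping.keys p \<union> Poly_Mapping.keys q"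
    have "F (p + q) = (\<Sum>k\<in>?S. Poly_Mapping.lookup (p + q) k *\<^sub>C f (fst k) (snd k))"
      by (rule F_eq) (use Poly_Mapping.keys_add[of p q] in auto)
    also have "\<dots> = F p + F q"
      by (subst (1 2) F_eq[of ?S]) (auto simp: lookup_add cv.scale_left_distrib sum.distrib)
    finally show ?thesis .
  qed
  have F_scale: "F (c *\<^sub>C p) = c *\<^sub>C F p" for c p
  proof -
    have "F (c *\<^sub>C p) = (\<Sum>k\<in>Poly_Mapping.keys p. Poly_Mapping.lookup (c *\<^sub>C p) k *\<^sub>C f (fst k) (snd k))"
      by (rule F_eq) (auto simp: in_keys_iff scaleC_poly_mapping.rep_eq)
    also have "\<dots> = c *\<^sub>C F p"
      by (simp add: F_def scaleC_poly_mapping.rep_eq cv.scale_sum_right scaleC_complex_def)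
    finally show ?thesis .
  qed
  have lin: "clinear F"
    by (simp add: clinear_iff F_add F_scale)
  interpret F: Vector_Spaces.linear scaleC scaleC F by (rule lin)
  have F_single: "F (Poly_Mapping.single (x, y) 1) = f x y" for x y
    by (simp add: F_def)
  have "F r = 0" if "r \<in> tensor_relators" for r
    using that assms
    by (auto simp: tensor_relators_def Let_def F.diff F.scale F_single cbilinear_def clinear_iff)
  then have F_0: "F p = 0" if "p \<in> cv.span tensor_relators" for p
    using F.eq_0_on_span that by blast
  have F_rel: "F p = F q" if "tensor_rel p q" for p q
    using F_0[of "p - q"] that by (simp add: tensor_rel_def F.diff)
  define g where "g t = F (rep_tensor t)" for t
  have g_abs: "g (abs_tensor p) = F p" for p
    unfolding g_def
    by (rule F_rel) (metis Quotient3_tensor Quotient3_rep_abs equivp_tensor_rel equivp_reflp)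
  have g_add: "g (s + t) = g s + g t" for s t
    by (metis F_add Quotient3_abs_rep Quotient3_tensor g_abs plus_tensor.abs_eq)
  have g_scale: "g (c *\<^sub>C t) = c *\<^sub>C g t" for c t
    by (metis F_scale Quotient3_abs_rep Quotient3_tensor g_abs scaleC_tensor.abs_eq)
  have "clinear g"
    by (simp add: clinear_iff g_add g_scale)
  moreover have "g (x \<otimes> y) = f x y" for x y
    by (simp add: pure_tensor.abs_eq g_abs F_single)
  moreover have "g' = g" if "clinear g'" "\<forall>x y. g' (x \<otimes> y) = f x y" for g'
    by (rule ext, rule tensor_ext[OF that(1) \<open>clinear g\<close>])
      (simp add: that(2) \<open>\<And>y x. g (x \<otimes> y) = f x y\<close>)
  ultimately show ?thesis
    by blast
qed

lemma
  assumes "cbilinear f"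
  shows clinear_tensor_lift: "clinear (tensor_lift f)"
    and tensor_lift_pure: "tensor_lift f (x \<otimes> y) = f x y"
  using theI'[OF ex1_tensor_lift[OF assms]] by (simp_all add: tensor_lift_def)

lemma clinear_tensor_lift_param:
  assumes bl: "\<And>u. cbilinear (f u)" and lin: "\<And>x y. clinear (\<lambda>u. f u x y)"
  shows "clinear (\<lambda>u. tensor_lift (f u) t)"
proof -
  have L: "tensor_lift (f u) (s + t) = tensor_lift (f u) s + tensor_lift (f u) t"
    "tensor_lift (f u) (c *\<^sub>C t) = c *\<^sub>C tensor_lift (f u) t" for u s t c
    using clinear_tensor_lift[OF bl] by (simp_all add: clinear_iff)
  have f: "f (u + v) x y = f u x y + f v x y" "f (c *\<^sub>C u) x y = c *\<^sub>C f u x y" for u v x y c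
    using lin by (simp_all add: clinear_iff)
  have "tensor_lift (f (u + v)) t = tensor_lift (f u) t + tensor_lift (f v) t" for u v
    by (rule tensor_ext[where f = "tensor_lift (f (u + v))"])
      (simp_all add: clinear_iff L f tensor_lift_pure[OF bl] cv.scale_right_distrib ac_simps)
  moreover have "tensor_lift (f (c *\<^sub>C u)) t = c *\<^sub>C tensor_lift (f u) t" for c u
    by (rule tensor_ext[where f = "tensor_lift (f (c *\<^sub>C u))"])
      (simp_all add: clinear_iff L f tensor_lift_pure[OF bl] cv.scale_right_distrib mult.commute)
  ultimately show ?thesis
    by (simp add: clinear_iff)
qed

definition tensor_map ::
    "('a::complex_vector \<Rightarrow> 'c::complex_vector) \<Rightarrow> ('b::complex_vector \<Rightarrow> 'd::complex_vector) \<Rightarrow>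
      ('a, 'b) tensor \<Rightarrow> ('c, 'd) tensor"
  where "tensor_map f g = tensor_lift (\<lambda>x y. f x \<otimes> g y)"

definition tensor_assoc ::
    "(('a::complex_vector, 'b::complex_vector) tensor, 'c::complex_vector) tensor \<Rightarrow>
      ('a, ('b, 'c) tensor) tensor"
  where "tensor_assoc = tensor_lift (\<lambda>t z. tensor_lift (\<lambda>x y. x \<otimes> (y \<otimes> z)) t)"

definition tensor_subspace ::
    "'a::complex_vector set \<Rightarrow> 'b::complex_vector set \<Rightarrow> ('a, 'b) tensor set"
  where "tensor_subspace V W = cv.span {v \<otimes> w | v w. v \<in> V \<and> w \<in> W}"


section \<open>Algebras\<close>

text \<open>The multiplication is a record field and not a type-class operation, because one vector space
  carries both the original and the deformed multiplication.\<close>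

record 'a calgebra =
  mult :: "'a \<Rightarrow> 'a \<Rightarrow> 'a"
  unit :: 'a

definition is_algebra :: "('a::complex_vector, 'z) calgebra_scheme \<Rightarrow> bool"
  where "is_algebra A \<longleftrightarrow>
    cbilinear (mult A) \<and>
    (\<forall>x y z. mult A (mult A x y) z = mult A x (mult A y z)) \<and>
    (\<forall>x. mult A (unit A) x = x \<and> mult A x (unit A) = x)"

definition subalgebra :: "('a::complex_vector, 'z) calgebra_scheme \<Rightarrow> 'a set \<Rightarrow> bool"
  where "subalgebra A B \<longleftrightarrow>
    cv.subspace B \<and> unit A \<in> B \<and> (\<forall>x\<in>B. \<forall>y\<in>B. mult A x y \<in> B)"

definition algebra_hom ::
    "('a::complex_vector, 'y) calgebra_scheme \<Rightarrow> ('b::complex_vector, 'z) calgebra_scheme \<Rightarrow>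
      ('a \<Rightarrow> 'b) \<Rightarrow> bool"
  where "algebra_hom A B f \<longleftrightarrow>
    clinear f \<and> (\<forall>x y. f (mult A x y) = mult B (f x) (f y)) \<and> f (unit A) = unit B"

definition complex_algebra :: "complex calgebra"
  where "complex_algebra = \<lparr>mult = (*), unit = 1\<rparr>"

definition tensor_algebra ::
    "('a::complex_vector, 'y) calgebra_scheme \<Rightarrow> ('b::complex_vector, 'z) calgebra_scheme \<Rightarrow>
      ('a, 'b) tensor calgebra"
  where "tensor_algebra A B =
    \<lparr>mult = (\<lambda>s t. tensor_lift (\<lambda>x y. tensor_lift (\<lambda>x' y'. mult A x x' \<otimes> mult B y y') t) s),
     unit = unit A \<otimes> unit B\<rparr>"


section \<open>Hopf algebras and comodule algebras\<close>

record (overloaded) ('h::complex_vector) hopf = "'h calgebra" +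
  comult :: "'h \<Rightarrow> ('h, 'h) tensor"
  counit :: "'h \<Rightarrow> complex"
  antipode :: "'h \<Rightarrow> 'h"

definition hopf_algebra :: "('h::complex_vector, 'z) hopf_scheme \<Rightarrow> bool"
  where "hopf_algebra H \<longleftrightarrow>
    is_algebra H \<and>
    algebra_hom H (tensor_algebra H H) (comult H) \<and>
    algebra_hom H complex_algebra (counit H) \<and>
    (\<forall>h. tensor_assoc (tensor_map (comult H) id (comult H h)) =
         tensor_map id (comult H) (comult H h)) \<and>
    (\<forall>h. tensor_lift (\<lambda>x y. counit H x *\<^sub>C y) (comult H h) = h \<and>
         tensor_lift (\<lambda>x y. counit H y *\<^sub>C x) (comult H h) = h) \<and>
    clinear (antipode H) \<and>
    (\<forall>h. tensor_lift (\<lambda>x y. mult H (antipode H x) y) (comult H h) = counit H h *\<^sub>C unit H \<and>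
         tensor_lift (\<lambda>x y. mult H x (antipode H y)) (comult H h) = counit H h *\<^sub>C unit H)"

record (overloaded) ('a::complex_vector, 'h::complex_vector) comodule = "'a calgebra" +
  coaction :: "'a \<Rightarrow> ('a, 'h) tensor"

definition comodule_algebra ::
    "('h::complex_vector, 'y) hopf_scheme \<Rightarrow> ('a::complex_vector, 'h, 'z) comodule_scheme \<Rightarrow> bool"
  where "comodule_algebra H A \<longleftrightarrow>
    is_algebra A \<and>
    algebra_hom A (tensor_algebra A H) (coaction A) \<and>
    (\<forall>a. tensor_assoc (tensor_map (coaction A) id (coaction A a)) =
         tensor_map id (comult H) (coaction A a)) \<and>
    (\<forall>a. tensor_lift (\<lambda>x h. counit H h *\<^sub>C x) (coaction A a) = a)"

definition coinvariants ::
    "('h::complex_vector, 'y) hopf_scheme \<Rightarrow> ('a::complex_vector, 'h, 'z) comodule_scheme \<Rightarrow> 'a set"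
  where "coinvariants H A = {b. coaction A b = b \<otimes> unit H}"


section \<open>Hopf-Galois extensions\<close>

text \<open>The tensor product of \<open>A\<close> with itself over \<open>B\<close> is the quotient of the tensor product over
  the complex numbers by the subspace generated by the following elements.\<close>

definition balanced_relators ::
    "('a::complex_vector, 'z) calgebra_scheme \<Rightarrow> 'a set \<Rightarrow> ('a, 'a) tensor set"
  where "balanced_relators A B = {mult A x b \<otimes> y - x \<otimes> mult A b y | x b y. b \<in> B}"

definition balanced_rel ::
    "('a::complex_vector, 'z) calgebra_scheme \<Rightarrow> 'a set \<Rightarrow> (('a, 'a) tensor \<times> ('a, 'a) tensor) set"
  where "balanced_rel A B = {(s, t). s - t \<in> cv.span (balanced_relators A B)}"

definition balanced_tensor ::
    "('a::complex_vector, 'z) calgebra_scheme \<Rightarrow> 'a set \<Rightarrow> ('a, 'a) tensor set set"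
  where "balanced_tensor A B = UNIV // balanced_rel A B"

definition pre_galois_map ::
    "('a::complex_vector, 'h::complex_vector, 'z) comodule_scheme \<Rightarrow> ('a, 'a) tensor \<Rightarrow> ('a, 'h) tensor"
  where "pre_galois_map A =
    tensor_lift (\<lambda>x a. tensor_lift (\<lambda>a0 a1. mult A x a0 \<otimes> a1) (coaction A a))"

text \<open>The induced map on classes; see \<open>galois_map_class\<close> below for its being well defined.\<close>

definition galois_map ::
    "('a::complex_vector, 'h::complex_vector, 'z) comodule_scheme \<Rightarrow> ('a, 'a) tensor set \<Rightarrow> ('a, 'h) tensor"
  where "galois_map A X = the_elem (pre_galois_map A ` X)"

text \<open>Since the canonical map is induced by the linear map \<^const>\<open>pre_galois_map\<close>, it is an isomorphism
  if and only if it is bijective.\<close>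

definition hopf_galois_extension ::
    "('h::complex_vector, 'y) hopf_scheme \<Rightarrow> 'a set \<Rightarrow>
      ('a::complex_vector, 'h, 'z) comodule_scheme \<Rightarrow> bool"
  where "hopf_galois_extension H B A \<longleftrightarrow>
    comodule_algebra H A \<and> B = coinvariants H A \<and>
    bij_betw (galois_map A) (balanced_tensor A B) UNIV"

lemma clinear_compose: "clinear f \<Longrightarrow> clinear g \<Longrightarrow> clinear (\<lambda>x. g (f x))"
  by (simp add: clinear_iff)

lemma cbilinear_left_mult:
  assumes "cbilinear m"
  shows "cbilinear (\<lambda>y h. m x y \<otimes> h)"
  using assms by (simp add: cbilinear_def clinear_iff pure_tensor_simps)

lemma cbilinear_pre_galois:
  fixes A :: "('a::complex_vector, 'h::complex_vector, 'z) comodule_scheme"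
  assumes "cbilinear (mult A)" "clinear (coaction A)"
  shows "cbilinear (\<lambda>x a. tensor_lift (\<lambda>a0 a1. mult A x a0 \<otimes> a1) (coaction A a))"
proof -
  let ?L = "\<lambda>x. tensor_lift (\<lambda>(a0::'a) (a1::'h). mult A x a0 \<otimes> a1)"
  have bl: "cbilinear (\<lambda>a0 (a1::'h). mult A x a0 \<otimes> a1)" for x
    by (rule cbilinear_left_mult[OF assms(1)])
  have lin: "clinear (?L x)" for x
    by (rule clinear_tensor_lift[OF bl])
  have "clinear (\<lambda>x. ?L x t)" for t
    using assms(1)
    by (intro clinear_tensor_lift_param bl) (simp add: cbilinear_def clinear_iff pure_tensor_simps)
  then show ?thesis
    using lin assms(2) by (simp add: cbilinear_def clinear_iff)
qed

lemma galois_map_class: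
  fixes H :: "('h::complex_vector, 'y) hopf_scheme"
    and A :: "('a::complex_vector, 'h, 'z) comodule_scheme"
  assumes H: "hopf_algebra H" and A: "comodule_algebra H A"
  shows "galois_map A (balanced_rel A (coinvariants H A) `` {t}) = pre_galois_map A t"
proof -
  let ?L = "\<lambda>x. tensor_lift (\<lambda>(a0::'a) (a1::'h). mult A x a0 \<otimes> a1)"
  let ?B = "coinvariants H A"
  from A have bm: "cbilinear (mult A)" and lc: "clinear (coaction A)"
    and assoc: "mult A (mult A x y) z = mult A x (mult A y z)"
    and mult: "coaction A (mult A x y) = mult (tensor_algebra A H) (coaction A x) (coaction A y)"
    for x y z
    by (auto simp: comodule_algebra_def is_algebra_def algebra_hom_def)
  from H have bmH: "cbilinear (mult H)" and unitH: "mult H (unit H) h = h" for h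
    by (auto simp: hopf_algebra_def is_algebra_def)
  have bl: "cbilinear (\<lambda>a0 (a1::'h). mult A x a0 \<otimes> a1)" for x
    by (rule cbilinear_left_mult[OF bm])
  have lin: "clinear (?L x)" for x
    by (rule clinear_tensor_lift[OF bl])
  note blp = cbilinear_pre_galois[OF bm lc]
  have pre: "pre_galois_map A (x \<otimes> y) = ?L x (coaction A y)" for x y
    unfolding pre_galois_map_def by (rule tensor_lift_pure[OF blp])
  have lin_pre: "clinear (pre_galois_map A)"
    unfolding pre_galois_map_def by (rule clinear_tensor_lift[OF blp])
  interpret P: Vector_Spaces.linear scaleC scaleC "pre_galois_map A" by (rule lin_pre)
  have LL: "?L x (?L b t) = ?L (mult A x b) t" for x b t
    by (rule tensor_ext[OF clinear_compose[OF lin lin] lin])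
      (simp add: tensor_lift_pure[OF bl] assoc[symmetric])
  have lift_unit: "mult (tensor_algebra A H) (b \<otimes> unit H) t = ?L b t" for b t
  proof -
    have bl2: "cbilinear (\<lambda>x' y'. mult A x x' \<otimes> mult H y y')" for x y
      using bm bmH by (simp add: cbilinear_def clinear_iff pure_tensor_simps)
    have "cbilinear (\<lambda>x y. tensor_lift (\<lambda>x' y'. mult A x x' \<otimes> mult H y y') t)"
      unfolding cbilinear_def using bm bmH
      by (intro conjI allI clinear_tensor_lift_param bl2)
        (simp_all add: cbilinear_def clinear_iff pure_tensor_simps)
    then show ?thesis
      by (simp add: tensor_algebra_def tensor_lift_pure unitH)
  qed
  have "pre_galois_map A r = 0" if "r \<in> balanced_relators A ?B" for r
  proof -
    from that obtain x b y where b: "b \<in> ?B" and r: "r = mult A x b \<otimes> y - x \<otimes> mult A b y"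
      by (auto simp: balanced_relators_def)
    have "coaction A (mult A b y) = ?L b (coaction A y)"
      using b by (simp add: mult coinvariants_def lift_unit)
    then show ?thesis
      by (simp add: r P.diff pre LL)
  qed
  then have zero: "pre_galois_map A r = 0" if "r \<in> cv.span (balanced_relators A ?B)" for r
    using P.eq_0_on_span that by blast
  have eq: "pre_galois_map A s = pre_galois_map A t" if "s \<in> balanced_rel A ?B `` {t}" for s
    using zero[of "t - s"] that by (simp add: balanced_rel_def P.diff)
  have ne: "balanced_rel A ?B `` {t} \<noteq> {}"
  proof -
    have "t \<in> balanced_rel A ?B `` {t}"
      by (simp add: balanced_rel_def cv.span_zero)
    then show ?thesis by blast
  qed
  have "pre_galois_map A ` (balanced_rel A ?B `` {t}) = (\<lambda>_. pre_galois_map A t) ` (balanced_rel A ?B `` {t})"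
    by (rule image_cong[OF refl eq])
  also have "\<dots> = {pre_galois_map A t}"
    using ne by (simp only: image_constant_conv if_False)
  finally have "pre_galois_map A ` (balanced_rel A ?B `` {t}) = {pre_galois_map A t}" .
  then show ?thesis
    by (simp add: galois_map_def)
qed


section \<open>Graded algebras and their deformations\<close>

text \<open>\<open>int ^ 'n\<close> is the group of integer vectors of length \<open>n = CARD('n)\<close>.\<close>

definition is_decomposition :: "(int ^ 'n \<Rightarrow> 'a::complex_vector set) \<Rightarrow> 'a \<Rightarrow> (int ^ 'n \<Rightarrow> 'a) \<Rightarrow> bool"
  where "is_decomposition G a f \<longleftrightarrow>
    finite {r. f r \<noteq> 0} \<and> (\<forall>r. f r \<in> G r) \<and> a = (\<Sum>r | f r \<noteq> 0. f r)"

definition graded_algebra ::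
    "('a::complex_vector, 'z) calgebra_scheme \<Rightarrow> (int ^ 'n \<Rightarrow> 'a set) \<Rightarrow> bool"
  where "graded_algebra A G \<longleftrightarrow>
    is_algebra A \<and>
    (\<forall>r. cv.subspace (G r)) \<and>
    (\<forall>a. \<exists>!f. is_decomposition G a f) \<and>
    (\<forall>r l. \<forall>x\<in>G r. \<forall>y\<in>G l. mult A x y \<in> G (r + l))"

definition component :: "(int ^ 'n \<Rightarrow> 'a::complex_vector set) \<Rightarrow> 'a \<Rightarrow> int ^ 'n \<Rightarrow> 'a"
  where "component G a = (THE f. is_decomposition G a f)"

definition twist :: "real ^ 'n ^ 'n \<Rightarrow> int ^ 'n \<Rightarrow> int ^ 'n \<Rightarrow> complex"
  where "twist \<theta> r l =
    exp (of_real pi * \<i> *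
      of_real ((\<theta> *v (\<chi> i. real_of_int (r $ i))) \<bullet> (\<chi> i. real_of_int (l $ i))))"

definition deformed_mult ::
    "real ^ 'n ^ 'n \<Rightarrow> (int ^ 'n \<Rightarrow> 'a::complex_vector set) \<Rightarrow> ('a \<Rightarrow> 'a \<Rightarrow> 'a) \<Rightarrow> 'a \<Rightarrow> 'a \<Rightarrow> 'a"
  where "deformed_mult \<theta> G m x y =
    (\<Sum>r | component G x r \<noteq> 0. \<Sum>l | component G y l \<noteq> 0.
      twist \<theta> r l *\<^sub>C m (component G x r) (component G y l))"

definition deform ::
    "real ^ 'n ^ 'n \<Rightarrow> (int ^ 'n \<Rightarrow> 'a::complex_vector set) \<Rightarrow>
      ('a, 'z) calgebra_scheme \<Rightarrow> ('a, 'z) calgebra_scheme"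
  where "deform \<theta> G A = A\<lparr>mult := deformed_mult \<theta> G (mult A)\<rparr>"

lemma component_homogeneous:
  assumes "graded_algebra A G" "x \<in> G r"
  shows "component G x = (\<lambda>s. if s = r then x else 0)"
proof -
  have "is_decomposition G x (\<lambda>s. if s = r then x else 0)"
  proof (cases "x = 0")
    case True
    then show ?thesis
      using assms by (auto simp: is_decomposition_def graded_algebra_def cv.subspace_0)
  next
    case False
    then have "{s. (if s = r then x else 0) \<noteq> 0} = {r}"
      by auto
    then show ?thesis
      using assms by (auto simp: is_decomposition_def graded_algebra_def cv.subspace_0)
  qed
  then show ?thesis
    using assms unfolding component_def graded_algebra_def by (intro the1_equality) auto
qed

lemma deformed_mult_homogeneous:
  assumes A: "graded_algebra A G" and x: "x \<in> G r" and y: "y \<in> G l"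
  shows "deformed_mult \<theta> G (mult A) x y = twist \<theta> r l *\<^sub>C mult A x y"
proof (cases "x = 0 \<or> y = 0")
  case True
  have "cbilinear (mult A)"
    using A by (simp add: graded_algebra_def is_algebra_def)
  then have "mult A 0 y = 0" "mult A x 0 = 0"
    unfolding cbilinear_def clinear_iff by (metis cv.scale_zero_left)+
  with True show ?thesis
    by (auto simp: deformed_mult_def component_homogeneous[OF A x] component_homogeneous[OF A y])
next
  case False
  then have "{s. (if s = r then x else 0) \<noteq> 0} = {r}" "{s. (if s = l then y else 0) \<noteq> 0} = {l}"
    by auto
  then show ?thesis
    by (simp add: deformed_mult_def component_homogeneous[OF A x] component_homogeneous[OF A y])
qed

end

theory Submission
  imports Defs
begin

text \<open>
  Write \<open>\<lambda>(r, l)\<close> for \<^const>\<open>twist\<close>. It is a bicharacter on the grading group, so in particular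
  it satisfies the cocycle identity \<open>\<lambda>(r, s) \<lambda>(r + s, l) = \<lambda>(s, l) \<lambda>(r, s + l)\<close>, and
  \<open>\<lambda>(0, l) = \<lambda>(r, 0) = 1\<close>. The first makes the deformed multiplication associative; the second
  keeps the unit, because the unit of a graded algebra has degree \<open>0\<close>.

  Everything about the coaction \<open>\<delta>\<close> rests on the fact that it preserves degrees: for \<open>x\<close> of degree
  \<open>r\<close> and \<open>y\<close> of degree \<open>l\<close>, passing from \<open>m\<close> to \<open>m\<^sub>\<theta>\<close> multiplies both \<open>x y\<close> and
  \<open>\<delta>(x) \<delta>(y)\<close> by the same scalar \<open>\<lambda>(r, l)\<close>. Hence \<open>\<delta>\<close> is still multiplicative
  (\<open>coaction_deform_mult\<close>), and coassociativity, the counit law and the set \<open>B\<close> of coinvariants do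
  not involve the multiplication at all.

  For the Galois property, let \<open>\<Phi>\<^sub>\<theta>\<close> be the automorphism of the vector space \<open>A \<otimes> A\<close> that
  multiplies \<open>A\<^sub>r \<otimes> A\<^sub>l\<close> by \<open>\<lambda>(r, l)\<close>; its inverse is \<open>\<Phi>\<close> for \<open>-\<theta>\<close>. The canonical map before
  passing to the quotient, \<open>P(x \<otimes> a) = x a\<^sub>0 \<otimes> a\<^sub>1\<close>, deforms to \<open>P\<^sub>\<theta> = P \<circ> \<Phi>\<^sub>\<theta>\<close>
  (\<open>pre_galois_deform\<close>). Also \<open>B\<close> is a graded subspace, so the span \<open>J\<close> of the relators
  \<open>x b \<otimes> y - x \<otimes> b y\<close> is spanned by the homogeneous ones, and by the cocycle identity the inverse
  of \<open>\<Phi>\<^sub>\<theta>\<close> maps each of these to a multiple of the corresponding relator of \<open>A\<^sub>\<theta>\<close>; it thus maps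
  \<open>J\<close> into the span \<open>J\<^sub>\<theta>\<close> of the deformed relators (\<open>twist_map_relators\<close>). The canonical map is bijective
  exactly if \<open>P\<close> is surjective with kernel inside \<open>J\<close>, and both properties are carried over from
  \<open>(P, J)\<close> to \<open>(P\<^sub>\<theta>, J\<^sub>\<theta>)\<close> by \<open>\<Phi>\<^sub>\<theta>\<close>.
\<close>


section \<open>Bilinear maps and tensor products\<close>

lemma cbilinear_iff:
  "cbilinear f \<longleftrightarrow>
    (\<forall>x x' y. f (x + x') y = f x y + f x' y) \<and> (\<forall>c x y. f (c *\<^sub>C x) y = c *\<^sub>C f x y) \<and>
    (\<forall>x y y'. f x (y + y') = f x y + f x y') \<and> (\<forall>c x y. f x (c *\<^sub>C y) = c *\<^sub>C f x y)"
  by (auto simp: cbilinear_def clinear_iff)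

lemma cbilinear_zero:
  assumes "cbilinear f"
  shows "f 0 y = 0" "f x 0 = 0"
  using assms unfolding cbilinear_iff by (metis cv.scale_zero_left)+

lemma clinear_sum:
  assumes "clinear f"
  shows "f (sum g S) = (\<Sum>i\<in>S. f (g i))"
  using assms by (rule Vector_Spaces.linear.axioms(3)[THEN module_hom.sum])

lemma clinear_pure_tensor_left: "clinear (\<lambda>x. x \<otimes> h)"
  by (simp add: clinear_iff pure_tensor_simps)

lemma tensor_subspace_ext:
  fixes f g :: "('a::complex_vector, 'b::complex_vector) tensor \<Rightarrow> 'c::complex_vector"
  assumes "clinear f" "clinear g" "t \<in> tensor_subspace V W"
    and "\<And>v w. v \<in> V \<Longrightarrow> w \<in> W \<Longrightarrow> f (v \<otimes> w) = g (v \<otimes> w)"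
  shows "f t = g t"
proof -
  interpret vector_space_pair
    "scaleC :: complex \<Rightarrow> ('a, 'b) tensor \<Rightarrow> _" "scaleC :: complex \<Rightarrow> 'c \<Rightarrow> _"
    by standard
  show ?thesis
    by (rule linear_eq_on[OF assms(1,2), of t "{v \<otimes> w | v w. v \<in> V \<and> w \<in> W}"])
      (use assms(3,4) in \<open>auto simp: tensor_subspace_def\<close>)
qed

lemma cbilinear_tensor_map:
  assumes "clinear f" "clinear g"
  shows "cbilinear (\<lambda>x y. f x \<otimes> g y)"
  using assms by (simp add: cbilinear_iff clinear_iff pure_tensor_simps)

lemma
  assumes "cbilinear (mult A)" "cbilinear (mult B)"
  shows cbilinear_tensor_algebra: "cbilinear (mult (tensor_algebra A B))"
    and tensor_algebra_pure:
      "mult (tensor_algebra A B) (x \<otimes> h) (y \<otimes> k) = mult A x y \<otimes> mult B h k"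
proof -
  have bl2: "cbilinear (\<lambda>x' y'. mult A x x' \<otimes> mult B y y')" for x y
    using assms by (simp add: cbilinear_iff pure_tensor_simps)
  have bl1: "cbilinear (\<lambda>x y. tensor_lift (\<lambda>x' y'. mult A x x' \<otimes> mult B y y') t)" for t
    unfolding cbilinear_def using assms
    by (intro conjI allI clinear_tensor_lift_param bl2)
      (simp_all add: cbilinear_def clinear_iff pure_tensor_simps)
  show "mult (tensor_algebra A B) (x \<otimes> h) (y \<otimes> k) = mult A x y \<otimes> mult B h k"
    by (simp add: tensor_algebra_def tensor_lift_pure[OF bl1] tensor_lift_pure[OF bl2])
  have "clinear (\<lambda>t. tensor_lift (\<lambda>x y. tensor_lift (\<lambda>x' y'. mult A x x' \<otimes> mult B y y') t) s)" for s
    by (rule clinear_tensor_lift_param[OF bl1 clinear_tensor_lift[OF bl2]])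
  then show "cbilinear (mult (tensor_algebra A B))"
    by (simp add: cbilinear_def tensor_algebra_def clinear_tensor_lift[OF bl1])
qed


section \<open>The bicharacter\<close>

lemma twist_add_left: "twist \<theta> (r + s) l = twist \<theta> r l * twist \<theta> s l"
proof -
  have "(\<chi> i. real_of_int ((r + s) $ i)) = (\<chi> i. real_of_int (r $ i)) + (\<chi> i. real_of_int (s $ i))"
    by (simp add: vec_eq_iff)
  then show ?thesis
    by (simp add: twist_def matrix_vector_right_distrib inner_add_left algebra_simps
        flip: exp_add)
qed

lemma twist_add_right: "twist \<theta> r (l + s) = twist \<theta> r l * twist \<theta> r s"
proof -
  have "(\<chi> i. real_of_int ((l + s) $ i)) = (\<chi> i. real_of_int (l $ i)) + (\<chi> i. real_of_int (s $ i))"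
    by (simp add: vec_eq_iff)
  then show ?thesis
    by (simp add: twist_def inner_add_right algebra_simps flip: exp_add)
qed

lemma twist_nonzero [simp]: "twist \<theta> r l \<noteq> 0"
  by (simp add: twist_def)

lemma twist_zero [simp]: "twist \<theta> 0 l = 1" "twist \<theta> r 0 = 1"
  using twist_add_left[of \<theta> 0 0 l] twist_add_right[of \<theta> r 0 0] by simp_all

lemma twist_minus: "twist (- \<theta>) r l = inverse (twist \<theta> r l)"
proof -
  have "(- \<theta>) *v v = - (\<theta> *v v)" for v
    by (simp add: vec_eq_iff matrix_vector_mult_def sum_negf)
  then show ?thesis
    by (simp add: twist_def exp_minus)
qed


section \<open>Homogeneous components\<close>

locale graded_alg =
  fixes A :: "('a::complex_vector, 'z) calgebra_scheme"
    and G :: "int ^ 'n \<Rightarrow> 'a set"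
  assumes graded: "graded_algebra A G"
begin

lemma subspace_G: "cv.subspace (G r)"
  and mult_G: "x \<in> G r \<Longrightarrow> y \<in> G l \<Longrightarrow> mult A x y \<in> G (r + l)"
  and algebra: "is_algebra A"
  and ex1_decomposition: "\<exists>!f. is_decomposition G a f"
  using graded unfolding graded_algebra_def by blast+

lemma cbilinear_mult: "cbilinear (mult A)"
  and mult_assoc: "mult A (mult A x y) z = mult A x (mult A y z)"
  and mult_unit: "mult A (unit A) x = x" "mult A x (unit A) = x"
  using algebra by (auto simp: is_algebra_def)

lemma decomposition_component: "is_decomposition G a (component G a)"
  unfolding component_def by (rule theI'[OF ex1_decomposition])

lemma component_in_G: "component G a r \<in> G r"
  and finite_component: "finite {r. component G a r \<noteq> 0}"
  and sum_component: "(\<Sum>r | component G a r \<noteq> 0. component G a r) = a"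
  using decomposition_component[of a] unfolding is_decomposition_def by auto

lemma component_eqI:
  assumes "finite S" "\<And>r. f r \<in> G r" "\<And>r. r \<notin> S \<Longrightarrow> f r = 0" "a = sum f S"
  shows "component G a = f"
proof -
  have "{r. f r \<noteq> 0} \<subseteq> S"
    using assms(3) by blast
  then have "is_decomposition G a f"
    unfolding is_decomposition_def using assms finite_subset
    by (auto intro: sum.mono_neutral_right)
  then show ?thesis
    using decomposition_component ex1_decomposition by blast
qed

lemma sum_component_superset:
  assumes "finite S" "{r. component G a r \<noteq> 0} \<subseteq> S"
  shows "sum (component G a) S = a"
  using sum.mono_neutral_left[OF assms, of "component G a"] sum_component[of a] by simp

lemma clinear_component: "clinear (\<lambda>a. component G a r)"
proof -
  have "component G (x + y) = (\<lambda>r. component G x r + component G y r)" for x y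
  proof (rule component_eqI)
    show "finite ({r. component G x r \<noteq> 0} \<union> {r. component G y r \<noteq> 0})"
      by (simp add: finite_component)
    then show "x + y = (\<Sum>r\<in>{r. component G x r \<noteq> 0} \<union> {r. component G y r \<noteq> 0}.
        component G x r + component G y r)"
      by (simp add: sum.distrib sum_component_superset)
  qed (auto intro: cv.subspace_add[OF subspace_G] component_in_G)
  moreover have "component G (c *\<^sub>C x) = (\<lambda>r. c *\<^sub>C component G x r)" for c x
    by (rule component_eqI[where S = "{r. component G x r \<noteq> 0}"])
      (auto intro: cv.subspace_scale[OF subspace_G] component_in_G
        simp: finite_component sum_component simp flip: cv.scale_sum_right)
  ultimately show ?thesis
    by (simp add: clinear_iff)
qed

lemma component_of_G: "x \<in> G r \<Longrightarrow> component G x s = (if s = r then x else 0)"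
  by (simp add: component_homogeneous[OF graded])

lemma component_induct:
  assumes "\<And>r. P (component G a r)" "P 0" "\<And>x y. P x \<Longrightarrow> P y \<Longrightarrow> P (x + y)"
  shows "P a"
proof -
  have "P (sum (component G a) S)" for S
    by (induction S rule: infinite_finite_induct) (use assms in auto)
  then show ?thesis
    using sum_component by metis
qed

lemma homogeneous_induct:
  assumes "\<And>r x. x \<in> G r \<Longrightarrow> P x" "\<And>x y. P x \<Longrightarrow> P y \<Longrightarrow> P (x + y)"
  shows "P a"
  by (rule component_induct[of P])
    (use assms in \<open>auto intro: component_in_G cv.subspace_0[OF subspace_G]\<close>)

lemma homogeneous_bilinear_ext:
  assumes f: "cbilinear f" and g: "cbilinear g"
    and eq: "\<And>r l x y. x \<in> G r \<Longrightarrow> y \<in> G l \<Longrightarrow> f x y = g x y"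
  shows "f x y = g x y"
proof (induction x rule: homogeneous_induct)
  case (1 r x)
  then show ?case
    by (induction y rule: homogeneous_induct) (use eq f g in \<open>auto simp: cbilinear_iff\<close>)
qed (use f g in \<open>simp add: cbilinear_iff\<close>)

lemma homogeneous_tensor_ext:
  assumes f: "clinear f" and g: "clinear g"
    and eq: "\<And>r l x y. x \<in> G r \<Longrightarrow> y \<in> G l \<Longrightarrow> f (x \<otimes> y) = g (x \<otimes> y)"
  shows "f t = g t"
proof (rule tensor_ext[OF f g])
  show "f (x \<otimes> y) = g (x \<otimes> y)" for x y
    by (rule homogeneous_bilinear_ext[of "\<lambda>x y. f (x \<otimes> y)" "\<lambda>x y. g (x \<otimes> y)"])
      (use f g eq in \<open>auto simp: cbilinear_iff clinear_iff pure_tensor_simps\<close>)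
qed

text \<open>The degree-zero component \<open>e\<close> of the unit is already a left unit: comparing degrees in
  \<open>x = 1 x\<close> gives \<open>e x = x\<close> for homogeneous \<open>x\<close>.\<close>

lemma unit_in_G_0: "unit A \<in> G 0"
proof -
  let ?e = "component G (unit A)"
  let ?S = "{r. ?e r \<noteq> 0}"
  have "mult A (?e 0) x = x" if x: "x \<in> G l" for l x
  proof -
    have lin: "clinear (\<lambda>a. component G (mult A a x) l)"
      using clinear_compose[OF _ clinear_component, of "\<lambda>a. mult A a x"] cbilinear_mult
      by (simp add: cbilinear_def)
    have "x = component G (mult A (unit A) x) l"
      using x by (simp add: mult_unit component_of_G)
    also have "\<dots> = component G (mult A (sum ?e ?S) x) l"
      by (simp add: sum_component)
    also have "\<dots> = (\<Sum>r\<in>?S. component G (mult A (?e r) x) l)"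
      by (rule clinear_sum[OF lin])
    also have "\<dots> = (\<Sum>r\<in>?S. if r = 0 then mult A (?e 0) x else 0)"
      by (intro sum.cong refl) (simp add: component_of_G[OF mult_G[OF component_in_G x]])
    also have "\<dots> = mult A (?e 0) x"
      using cbilinear_zero[OF cbilinear_mult] by (simp add: finite_component)
    finally show ?thesis ..
  qed
  then have "mult A (?e 0) x = x" for x
    by (induction x rule: homogeneous_induct) (use cbilinear_mult in \<open>auto simp: cbilinear_iff\<close>)
  from this[of "unit A"] have "?e 0 = unit A"
    by (simp add: mult_unit)
  then show ?thesis
    using component_in_G by metis
qed


section \<open>Twisted bilinear maps\<close>

text \<open>The same formula twists the multiplication \<open>A \<times> A \<rightarrow> A\<close> and the universal bilinear map
  \<open>A \<times> A \<rightarrow> A \<otimes> A\<close>, so the codomain is left arbitrary.\<close>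

definition twist_bilinear ::
    "real ^ 'n ^ 'n \<Rightarrow> ('a \<Rightarrow> 'a \<Rightarrow> 'c::complex_vector) \<Rightarrow> 'a \<Rightarrow> 'a \<Rightarrow> 'c"
  where "twist_bilinear \<theta> f x y =
    (\<Sum>r | component G x r \<noteq> 0. \<Sum>l | component G y l \<noteq> 0.
      twist \<theta> r l *\<^sub>C f (component G x r) (component G y l))"

lemma deformed_mult_eq: "deformed_mult \<theta> G m = twist_bilinear \<theta> m"
  by (simp add: fun_eq_iff deformed_mult_def twist_bilinear_def)

lemma twist_bilinear_superset:
  assumes f: "cbilinear f"
    and S: "finite S" "{r. component G x r \<noteq> 0} \<subseteq> S"
    and T: "finite T" "{l. component G y l \<noteq> 0} \<subseteq> T"
  shows "twist_bilinear \<theta> f x y =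
    (\<Sum>r\<in>S. \<Sum>l\<in>T. twist \<theta> r l *\<^sub>C f (component G x r) (component G y l))"
proof -
  have "(\<Sum>r\<in>S. \<Sum>l\<in>T. twist \<theta> r l *\<^sub>C f (component G x r) (component G y l)) =
      (\<Sum>r\<in>S. \<Sum>l | component G y l \<noteq> 0. twist \<theta> r l *\<^sub>C f (component G x r) (component G y l))"
    using T by (intro sum.cong refl sum.mono_neutral_right) (auto simp: cbilinear_zero[OF f])
  also have "\<dots> = twist_bilinear \<theta> f x y"
    unfolding twist_bilinear_def
    using S by (intro sum.mono_neutral_right) (auto simp: cbilinear_zero[OF f])
  finally show ?thesis ..
qed

lemma cbilinear_twist_bilinear:
  assumes f: "cbilinear f"
  shows "cbilinear (twist_bilinear \<theta> f)"
proof -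
  note comp = clinear_component[unfolded clinear_iff]
  let ?supp = "\<lambda>x. {r. component G x r \<noteq> 0}"
  have "twist_bilinear \<theta> f (x + x') y = twist_bilinear \<theta> f x y + twist_bilinear \<theta> f x' y" for x x' y
    using f
    by (subst (1 2 3) twist_bilinear_superset[OF f, where S = "?supp x \<union> ?supp x'" and T = "?supp y"])
      (auto simp: comp finite_component cbilinear_iff cv.scale_right_distrib sum.distrib)
  moreover have "twist_bilinear \<theta> f x (y + y') = twist_bilinear \<theta> f x y + twist_bilinear \<theta> f x y'"
    for x y y'
    using f
    by (subst (1 2 3) twist_bilinear_superset[OF f, where S = "?supp x" and T = "?supp y \<union> ?supp y'"])
      (auto simp: comp finite_component cbilinear_iff cv.scale_right_distrib sum.distrib)
  moreover have "twist_bilinear \<theta> f (c *\<^sub>C x) y = c *\<^sub>C twist_bilinear \<theta> f x y" for c x y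
    using f
    by (subst (1 2) twist_bilinear_superset[OF f, where S = "?supp x" and T = "?supp y"])
      (auto simp: comp finite_component cbilinear_iff cv.scale_sum_right mult.commute)
  moreover have "twist_bilinear \<theta> f x (c *\<^sub>C y) = c *\<^sub>C twist_bilinear \<theta> f x y" for c x y
    using f
    by (subst (1 2) twist_bilinear_superset[OF f, where S = "?supp x" and T = "?supp y"])
      (auto simp: comp finite_component cbilinear_iff cv.scale_sum_right mult.commute)
  ultimately show ?thesis
    by (simp add: cbilinear_iff)
qed

lemma twist_bilinear_homogeneous:
  assumes f: "cbilinear f" and x: "x \<in> G r" and y: "y \<in> G l"
  shows "twist_bilinear \<theta> f x y = twist \<theta> r l *\<^sub>C f x y"
proof -
  have "twist_bilinear \<theta> f x y =
      (\<Sum>s\<in>{r}. \<Sum>t\<in>{l}. twist \<theta> s t *\<^sub>C f (component G x s) (component G y t))"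
    by (rule twist_bilinear_superset[OF f]) (auto simp: component_of_G[OF x] component_of_G[OF y])
  then show ?thesis
    by (simp add: component_of_G[OF x] component_of_G[OF y])
qed

definition twist_map :: "real ^ 'n ^ 'n \<Rightarrow> ('a, 'a) tensor \<Rightarrow> ('a, 'a) tensor"
  where "twist_map \<theta> = tensor_lift (twist_bilinear \<theta> (\<otimes>))"

lemma clinear_twist_map: "clinear (twist_map \<theta>)"
  unfolding twist_map_def
  by (rule clinear_tensor_lift[OF cbilinear_twist_bilinear[OF cbilinear_pure_tensor]])

lemma twist_map_homogeneous:
  "x \<in> G r \<Longrightarrow> y \<in> G l \<Longrightarrow> twist_map \<theta> (x \<otimes> y) = twist \<theta> r l *\<^sub>C (x \<otimes> y)"
  by (simp add: twist_map_def tensor_lift_pure cbilinear_twist_bilinear cbilinear_pure_tensor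
      twist_bilinear_homogeneous)

lemma twist_map_minus: "twist_map (- \<theta>) (twist_map \<theta> t) = t"
  and twist_map_minus': "twist_map \<theta> (twist_map (- \<theta>) t) = t"
proof -
  have *: "twist_map \<theta>' (twist_map \<theta>'' t) = t"
    if "\<And>r l. twist \<theta>' r l * twist \<theta>'' r l = 1" for \<theta>' \<theta>'' t
  proof (rule homogeneous_tensor_ext[OF clinear_compose[OF clinear_twist_map clinear_twist_map]])
    show "clinear (\<lambda>t::('a, 'a) tensor. t)"
      by (simp add: clinear_iff)
    show "twist_map \<theta>' (twist_map \<theta>'' (x \<otimes> y)) = x \<otimes> y" if "x \<in> G r" "y \<in> G l" for r l x y
      using that clinear_twist_map[of \<theta>']
        \<open>\<And>r l. twist \<theta>' r l * twist \<theta>'' r l = 1\<close>[of r l]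
      by (simp add: twist_map_homogeneous clinear_iff mult.commute)
  qed
  show "twist_map (- \<theta>) (twist_map \<theta> t) = t" "twist_map \<theta> (twist_map (- \<theta>) t) = t"
    by (rule *, simp add: twist_minus)+
qed


section \<open>The deformed algebra\<close>

lemma deform_simps:
  "mult (deform \<theta> G A) = deformed_mult \<theta> G (mult A)" "unit (deform \<theta> G A) = unit A"
  by (simp_all add: deform_def)

lemma cbilinear_deformed_mult: "cbilinear (deformed_mult \<theta> G (mult A))"
  unfolding deformed_mult_eq by (rule cbilinear_twist_bilinear[OF cbilinear_mult])

lemma deformed_mult_assoc:
  "deformed_mult \<theta> G (mult A) (deformed_mult \<theta> G (mult A) x y) z =
    deformed_mult \<theta> G (mult A) x (deformed_mult \<theta> G (mult A) y z)" (is "?L x y z = ?R x y z")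
proof -
  note bl = cbilinear_deformed_mult[of \<theta>, unfolded cbilinear_iff]
  show ?thesis
  proof (induction x rule: homogeneous_induct)
    case x: (1 r x)
    show ?case
    proof (induction y rule: homogeneous_induct)
      case y: (1 s y)
      show ?case
      proof (induction z rule: homogeneous_induct)
        case z: (1 l z)
        show ?case
          using bl cbilinear_mult[unfolded cbilinear_iff]
          by (simp add: deformed_mult_homogeneous[OF graded x y] deformed_mult_homogeneous[OF graded y z]
              deformed_mult_homogeneous[OF graded mult_G[OF x y] z]
              deformed_mult_homogeneous[OF graded x mult_G[OF y z]]
              twist_add_left twist_add_right mult_assoc mult_ac)
      qed (simp add: bl)
    qed (simp add: bl)
  qed (simp add: bl)
qed

lemma deformed_mult_unit:
  "deformed_mult \<theta> G (mult A) (unit A) x = x" "deformed_mult \<theta> G (mult A) x (unit A) = x"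
proof -
  note bl = cbilinear_deformed_mult[of \<theta>, unfolded cbilinear_iff]
  show "deformed_mult \<theta> G (mult A) (unit A) x = x"
    by (induction x rule: homogeneous_induct)
      (simp_all add: bl deformed_mult_homogeneous[OF graded unit_in_G_0] mult_unit)
  show "deformed_mult \<theta> G (mult A) x (unit A) = x"
    by (induction x rule: homogeneous_induct)
      (simp_all add: bl deformed_mult_homogeneous[OF graded _ unit_in_G_0] mult_unit)
qed

lemma is_algebra_deform: "is_algebra (deform \<theta> G A)"
  by (simp add: is_algebra_def deform_simps cbilinear_deformed_mult deformed_mult_assoc
      deformed_mult_unit)

end


section \<open>The coaction on the deformed algebra\<close>

locale graded_comodule_alg = graded_alg A G
  for A :: "('a::complex_vector, 'h::complex_vector, 'z) comodule_scheme"
    and G :: "int ^ 'n \<Rightarrow> 'a set" +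
  fixes H :: "('h, 'y) hopf_scheme"
  assumes hopf: "hopf_algebra H"
    and comodule: "comodule_algebra H A"
    and coaction_graded: "coaction A ` G r \<subseteq> tensor_subspace (G r) UNIV"
begin

lemma cbilinear_mult_H: "cbilinear (mult H)"
  using hopf by (simp add: hopf_algebra_def is_algebra_def)

lemma clinear_coaction: "clinear (coaction A)"
  and coaction_mult:
    "coaction A (mult A x y) = mult (tensor_algebra A H) (coaction A x) (coaction A y)"
  and coaction_unit: "coaction A (unit A) = unit A \<otimes> unit H"
  using comodule by (simp_all add: comodule_algebra_def algebra_hom_def tensor_algebra_def)

lemma coaction_in: "x \<in> G r \<Longrightarrow> coaction A x \<in> tensor_subspace (G r) UNIV"
  using coaction_graded by blast

lemma coaction_deform [simp]: "coaction (deform \<theta> G A) = coaction A"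
  by (simp add: deform_def)

lemma coinvariants_deform [simp]: "coinvariants H (deform \<theta> G A) = coinvariants H A"
  by (simp add: coinvariants_def)

text \<open>The second tensor factor \<open>H\<close> has degree \<open>0\<close> throughout, so in \<open>A\<^sub>\<theta> \<otimes> H\<close> only the degrees of
  the first factors matter.\<close>

lemma tensor_algebra_deform_homogeneous:
  assumes s: "s \<in> tensor_subspace (G r) UNIV" and t: "t \<in> tensor_subspace (G l) UNIV"
  shows "mult (tensor_algebra (deform \<theta> G A) H) s t =
    twist \<theta> r l *\<^sub>C mult (tensor_algebra A H) s t"
proof -
  have bD: "cbilinear (mult (deform \<theta> G A))"
    by (simp add: deform_simps cbilinear_deformed_mult)
  note bl = cbilinear_tensor_algebra[OF bD cbilinear_mult_H]
    cbilinear_tensor_algebra[OF cbilinear_mult cbilinear_mult_H]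
  note pure = tensor_algebra_pure[OF bD cbilinear_mult_H]
    tensor_algebra_pure[OF cbilinear_mult cbilinear_mult_H]
  have pure_left: "mult (tensor_algebra (deform \<theta> G A) H) (v \<otimes> h) t =
      twist \<theta> r l *\<^sub>C mult (tensor_algebra A H) (v \<otimes> h) t" if v: "v \<in> G r" for v h
    by (rule tensor_subspace_ext[OF _ _ t])
      (use bl v in \<open>auto simp: cbilinear_def clinear_iff pure deform_simps pure_tensor_simps
        deformed_mult_homogeneous[OF graded] cv.scale_right_distrib mult.commute\<close>)
  show ?thesis
    by (rule tensor_subspace_ext[OF _ _ s])
      (use bl pure_left in \<open>auto simp: cbilinear_def clinear_iff cv.scale_right_distrib mult.commute\<close>)
qed

lemma coaction_deform_mult:
  "coaction A (deformed_mult \<theta> G (mult A) x y) =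
    mult (tensor_algebra (deform \<theta> G A) H) (coaction A x) (coaction A y)"
proof (rule homogeneous_bilinear_ext
    [of "\<lambda>x y. coaction A (deformed_mult \<theta> G (mult A) x y)"])
  show "cbilinear (\<lambda>x y. coaction A (deformed_mult \<theta> G (mult A) x y))"
    using cbilinear_deformed_mult[of \<theta>] clinear_coaction by (simp add: cbilinear_iff clinear_iff)
  have "cbilinear (mult (tensor_algebra (deform \<theta> G A) H))"
    by (rule cbilinear_tensor_algebra)
      (simp_all add: deform_simps cbilinear_deformed_mult cbilinear_mult_H)
  then show "cbilinear (\<lambda>x y. mult (tensor_algebra (deform \<theta> G A) H) (coaction A x) (coaction A y))"
    using clinear_coaction by (simp add: cbilinear_iff clinear_iff)
  show "coaction A (deformed_mult \<theta> G (mult A) x y) =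
      mult (tensor_algebra (deform \<theta> G A) H) (coaction A x) (coaction A y)"
    if "x \<in> G r" "y \<in> G l" for r l x y
    using that clinear_coaction
    by (simp add: deformed_mult_homogeneous[OF graded] clinear_iff coaction_mult
        tensor_algebra_deform_homogeneous[OF coaction_in coaction_in])
qed

lemma comodule_algebra_deform: "comodule_algebra H (deform \<theta> G A)"
proof -
  have "algebra_hom (deform \<theta> G A) (tensor_algebra (deform \<theta> G A) H) (coaction A)"
    unfolding algebra_hom_def deform_simps
    by (simp add: clinear_coaction coaction_deform_mult coaction_unit)
      (simp add: tensor_algebra_def deform_simps)
  then show ?thesis
    using comodule is_algebra_deform[of \<theta>] by (simp add: comodule_algebra_def)
qed

end

lemma subalgebra_coinvariants:
  fixes H :: "('h::complex_vector, 'y) hopf_scheme"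
    and A :: "('a::complex_vector, 'h, 'z) comodule_scheme"
  assumes H: "hopf_algebra H" and A: "comodule_algebra H A"
  shows "subalgebra A (coinvariants H A)"
proof -
  have bl: "cbilinear (mult A)" "cbilinear (mult H)" and unitH: "mult H (unit H) (unit H) = unit H"
    and lin: "clinear (coaction A)"
    and mult: "coaction A (mult A x y) = mult (tensor_algebra A H) (coaction A x) (coaction A y)"
    and one: "coaction A (unit A) = unit A \<otimes> unit H" for x y
    using H A by (auto simp: hopf_algebra_def comodule_algebra_def is_algebra_def algebra_hom_def
        tensor_algebra_def)
  have zero: "coaction A 0 = 0" "0 \<otimes> unit H = (0 :: ('a, 'h) tensor)"
    using clinear_sum[OF lin, of _ "{}"]
      clinear_sum[OF clinear_pure_tensor_left, of _ "{}" "unit H"] by simp_all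
  show ?thesis
    using lin zero one
    by (auto simp: subalgebra_def cv.subspace_def coinvariants_def clinear_iff pure_tensor_simps
        mult tensor_algebra_pure[OF bl] unitH)
qed


section \<open>The canonical map of the deformed algebra\<close>

text \<open>The canonical map is induced by the linear map \<^const>\<open>pre_galois_map\<close>, which vanishes on the
  relators, so it is injective if and only if every element of the kernel already represents the
  zero class.\<close>

lemma bij_galois_map_iff:
  fixes H :: "('h::complex_vector, 'y) hopf_scheme"
    and A :: "('a::complex_vector, 'h, 'z) comodule_scheme"
  assumes H: "hopf_algebra H" and A: "comodule_algebra H A"
  shows "bij_betw (galois_map A) (balanced_tensor A (coinvariants H A)) UNIV \<longleftrightarrow>
    surj (pre_galois_map A) \<and>
    (\<forall>t. pre_galois_map A t = 0 \<longrightarrow> t \<in> cv.span (balanced_relators A (coinvariants H A)))"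
proof -
  let ?P = "pre_galois_map A" and ?J = "cv.span (balanced_relators A (coinvariants H A))"
  let ?R = "balanced_rel A (coinvariants H A)"
  have lin: "clinear ?P"
    unfolding pre_galois_map_def
    by (rule clinear_tensor_lift, rule cbilinear_pre_galois)
      (use A in \<open>simp_all add: comodule_algebra_def is_algebra_def algebra_hom_def\<close>)
  interpret P: Vector_Spaces.linear scaleC scaleC ?P by (rule lin)
  have equiv: "equiv UNIV ?R"
  proof (rule equivI)
    show "sym ?R"
      unfolding sym_def balanced_rel_def
      by (simp, metis cv.span_neg minus_diff_eq)
    show "trans ?R"
    proof (rule transI)
      show "(s, u) \<in> ?R" if "(s, t) \<in> ?R" "(t, u) \<in> ?R" for s t u
        using cv.span_add[of "s - t" _ "t - u"] that by (simp add: balanced_rel_def)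
    qed
  qed (auto simp: refl_on_def balanced_rel_def cv.span_zero)
  have class_eq: "?R `` {s} = ?R `` {t} \<longleftrightarrow> s - t \<in> ?J" for s t
    using eq_equiv_class_iff[OF equiv, of s t] by (simp add: balanced_rel_def)
  have quotient: "balanced_tensor A (coinvariants H A) = range (\<lambda>t. ?R `` {t})"
    by (auto simp: balanced_tensor_def quotient_def)
  have image: "galois_map A ` balanced_tensor A (coinvariants H A) = range ?P"
    by (simp add: quotient image_image galois_map_class[OF H A])
  have "inj_on (galois_map A) (balanced_tensor A (coinvariants H A)) \<longleftrightarrow>
      (\<forall>s t. ?P s = ?P t \<longrightarrow> s - t \<in> ?J)"
    by (auto simp: inj_on_def quotient galois_map_class[OF H A] class_eq)
  also have "\<dots> \<longleftrightarrow> (\<forall>t. ?P t = 0 \<longrightarrow> t \<in> ?J)"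
  proof
    show "\<forall>t. ?P t = 0 \<longrightarrow> t \<in> ?J" if "\<forall>s t. ?P s = ?P t \<longrightarrow> s - t \<in> ?J"
      using that[rule_format, of _ 0] by (simp add: P.zero)
    show "\<forall>s t. ?P s = ?P t \<longrightarrow> s - t \<in> ?J" if "\<forall>t. ?P t = 0 \<longrightarrow> t \<in> ?J"
      using that by (simp add: P.diff)
  qed
  finally show ?thesis
    unfolding bij_betw_def image by blast
qed

context graded_comodule_alg
begin

text \<open>Since the coaction preserves degrees, projecting to degree \<open>r\<close> commutes with it. Projecting
  the equation \<open>\<delta>(b) = b \<otimes> 1\<close> therefore shows that the coinvariants form a graded subspace.\<close>

lemma coinvariants_component:
  assumes b: "b \<in> coinvariants H A"
  shows "component G b r \<in> coinvariants H A"
proof -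
  have lin_id: "clinear (\<lambda>h :: 'h. h)"
    by (simp add: clinear_iff)
  let ?p = "tensor_map (\<lambda>a. component G a r) (\<lambda>h :: 'h. h)"
  note bl = cbilinear_tensor_map[OF clinear_component lin_id]
  have lin_p: "clinear ?p"
    unfolding tensor_map_def by (rule clinear_tensor_lift[OF bl])
  have p_pure: "?p (x \<otimes> h) = component G x r \<otimes> h" for x h
    unfolding tensor_map_def by (subst tensor_lift_pure[OF bl]) simp
  have proj: "?p t = (if s = r then t else 0)" if "t \<in> tensor_subspace (G s) UNIV" for s t
    by (rule tensor_subspace_ext[OF lin_p _ that])
      (auto simp: clinear_iff p_pure component_of_G cbilinear_zero[OF cbilinear_pure_tensor])
  have "?p (coaction A a) = coaction A (component G a r)" for a
  proof (induction a rule: homogeneous_induct)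
    case (1 s x)
    have "coaction A 0 = 0"
      using clinear_sum[OF clinear_coaction, of _ "{}"] by simp
    with 1 show ?case
      by (simp add: proj[OF coaction_in[OF 1]] component_of_G)
  qed (use lin_p clinear_coaction clinear_component in \<open>simp add: clinear_iff\<close>)
  from this[of b] show ?thesis
    using b by (simp add: coinvariants_def p_pure)
qed

lemma cbilinear_pre_galois_A:
  "cbilinear (\<lambda>x a. tensor_lift (\<lambda>a0 a1. mult A x a0 \<otimes> a1) (coaction A a))"
  by (rule cbilinear_pre_galois[OF cbilinear_mult clinear_coaction])

lemma clinear_pre_galois: "clinear (pre_galois_map A)"
  unfolding pre_galois_map_def by (rule clinear_tensor_lift[OF cbilinear_pre_galois_A])

lemma pre_galois_pure:
  "pre_galois_map A (x \<otimes> y) = tensor_lift (\<lambda>a0 a1. mult A x a0 \<otimes> a1) (coaction A y)"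
  unfolding pre_galois_map_def by (rule tensor_lift_pure[OF cbilinear_pre_galois_A])

text \<open>For \<open>y\<close> of degree \<open>l\<close> all the \<open>y\<^sub>0\<close> in \<open>\<delta>(y) = y\<^sub>0 \<otimes> y\<^sub>1\<close> have degree \<open>l\<close>, so the factor
  by which the deformation changes \<open>x y\<^sub>0\<close> is \<open>\<lambda>(r, l)\<close>, the one that \<open>\<Phi>\<^sub>\<theta>\<close> attaches to \<open>x \<otimes> y\<close>.\<close>

lemma pre_galois_deform:
  "pre_galois_map (deform \<theta> G A) t = pre_galois_map A (twist_map \<theta> t)"
proof -
  have bD: "cbilinear (mult (deform \<theta> G A))"
    by (simp add: deform_simps cbilinear_deformed_mult)
  have bP: "cbilinear (\<lambda>x a. tensor_lift (\<lambda>a0 a1. mult (deform \<theta> G A) x a0 \<otimes> a1)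
      (coaction (deform \<theta> G A) a))"
    by (rule cbilinear_pre_galois[OF bD]) (simp add: clinear_coaction)
  have bl: "cbilinear (\<lambda>a0 (a1::'h). mult A x a0 \<otimes> a1)"
    and blD: "cbilinear (\<lambda>a0 (a1::'h). mult (deform \<theta> G A) x a0 \<otimes> a1)" for x
    by (rule cbilinear_left_mult[OF cbilinear_mult], rule cbilinear_left_mult[OF bD])
  show ?thesis
  proof (rule homogeneous_tensor_ext[OF _ clinear_compose[OF clinear_twist_map clinear_pre_galois]])
    show "clinear (pre_galois_map (deform \<theta> G A))"
      unfolding pre_galois_map_def by (rule clinear_tensor_lift[OF bP])
    fix r l x y assume x: "x \<in> G r" and y: "y \<in> G l"
    have "pre_galois_map (deform \<theta> G A) (x \<otimes> y) =
        tensor_lift (\<lambda>a0 a1. mult (deform \<theta> G A) x a0 \<otimes> a1) (coaction A y)"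
      unfolding pre_galois_map_def tensor_lift_pure[OF bP] by simp
    also have "\<dots> = twist \<theta> r l *\<^sub>C tensor_lift (\<lambda>a0 a1. mult A x a0 \<otimes> a1) (coaction A y)"
    proof (rule tensor_subspace_ext[OF clinear_tensor_lift[OF blD] _ coaction_in[OF y]])
      show "clinear (\<lambda>t. twist \<theta> r l *\<^sub>C tensor_lift (\<lambda>a0 (a1::'h). mult A x a0 \<otimes> a1) t)"
        using clinear_tensor_lift[OF bl]
        by (simp add: clinear_iff cv.scale_right_distrib mult.commute)
    qed (simp add: tensor_lift_pure[OF bl] tensor_lift_pure[OF blD[unfolded deform_simps]] deform_simps
        deformed_mult_homogeneous[OF graded x] pure_tensor_simps)
    also have "\<dots> = pre_galois_map A (twist_map \<theta> (x \<otimes> y))"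
      using clinear_pre_galois
      by (simp add: twist_map_homogeneous[OF x y] clinear_iff pre_galois_pure)
    finally show "pre_galois_map (deform \<theta> G A) (x \<otimes> y) = pre_galois_map A (twist_map \<theta> (x \<otimes> y))" .
  qed
qed

lemma twist_map_relators:
  assumes "t \<in> cv.span (balanced_relators A (coinvariants H A))"
  shows "twist_map (- \<theta>) t \<in> cv.span (balanced_relators (deform \<theta> G A) (coinvariants H A))"
    (is "_ \<in> ?J")
proof -
  interpret T: Vector_Spaces.linear scaleC scaleC "twist_map (- \<theta>)"
    by (rule clinear_twist_map)
  let ?B = "coinvariants H A"
  let ?r = "\<lambda>x b y. mult A x b \<otimes> y - x \<otimes> mult A b y"
  let ?f = "\<lambda>x b y. twist_map (- \<theta>) (?r x b y)"
  note bl = cbilinear_mult[unfolded cbilinear_iff]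
  have add: "?f (x + x') b y = ?f x b y + ?f x' b y" "?f x (b + b') y = ?f x b y + ?f x b' y"
    "?f x b (y + y') = ?f x b y + ?f x b y'" for x x' b b' y y'
    by (simp_all add: bl pure_tensor_simps T.add T.diff)
  have homogeneous: "?f x b y \<in> ?J" if x: "x \<in> G r" and b: "b \<in> G s" "b \<in> ?B" and y: "y \<in> G l"
    for r s l x b y
  proof -
    let ?d = "mult (deform \<theta> G A) x b \<otimes> y - x \<otimes> mult (deform \<theta> G A) b y"
    \<comment> \<open>Undoing \<open>m\<^sub>\<theta>\<close> costs \<open>\<lambda>(r, s)\<close> in the first term and \<open>\<lambda>(s, l)\<close> in the second; by the cocycle
      identity both terms end up with the same factor \<open>c\<close>.\<close>
    define c where "c = inverse (twist \<theta> r s * twist \<theta> r l * twist \<theta> s l)"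
    have scalars: "twist (- \<theta>) (r + s) l = c * twist \<theta> r s" "twist (- \<theta>) r (s + l) = c * twist \<theta> s l"
      by (simp_all add: c_def twist_minus twist_add_left twist_add_right)
    have "?f x b y = c *\<^sub>C ?d"
      by (simp add: T.diff twist_map_homogeneous[OF mult_G[OF x b(1)] y]
          twist_map_homogeneous[OF x mult_G[OF b(1) y]] deform_simps
          deformed_mult_homogeneous[OF graded x b(1)] deformed_mult_homogeneous[OF graded b(1) y]
          scalars pure_tensor_simps cv.scale_right_diff_distrib)
    moreover have "?d \<in> ?J"
      using b(2) by (intro cv.span_base) (auto simp: balanced_relators_def)
    ultimately show ?thesis
      by (simp add: cv.span_scale)
  qed
  have "?f x b y \<in> ?J" if b: "b \<in> ?B" for x b y
  proof (induction x rule: homogeneous_induct)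
    case x: (1 r x)
    show ?case
    proof (induction y rule: homogeneous_induct)
      case y: (1 l y)
      show ?case
      proof (induction b rule: component_induct)
        case (1 s)
        show ?case
          by (rule homogeneous[OF x component_in_G coinvariants_component[OF b] y])
      next
        case 2
        show ?case
          using cv.span_zero
          by (simp add: cbilinear_zero[OF cbilinear_mult] cbilinear_zero[OF cbilinear_pure_tensor]
              T.zero)
      qed (simp only: add cv.span_add)
    qed (simp only: add cv.span_add)
  qed (simp only: add cv.span_add)
  then have relator: "twist_map (- \<theta>) t \<in> ?J" if "t \<in> balanced_relators A ?B" for t
    using that by (auto simp: balanced_relators_def)
  have "cv.subspace {t. twist_map (- \<theta>) t \<in> ?J}"
    by (auto simp: cv.subspace_def T.zero T.add T.scale cv.span_zero cv.span_add cv.span_scale)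
  with assms relator show ?thesis
    using cv.span_minimal[of "balanced_relators A ?B" "{t. twist_map (- \<theta>) t \<in> ?J}"] by blast
qed

lemma hopf_galois_deform:
  assumes "hopf_galois_extension H (coinvariants H A) A"
  shows "hopf_galois_extension H (coinvariants H A) (deform \<theta> G A)"
proof -
  have surj: "surj (pre_galois_map A)"
    and kernel: "pre_galois_map A t = 0 \<Longrightarrow> t \<in> cv.span (balanced_relators A (coinvariants H A))" for t
    using assms bij_galois_map_iff[OF hopf comodule] by (auto simp: hopf_galois_extension_def)
  have "surj (pre_galois_map (deform \<theta> G A))"
  proof (rule surjI)
    show "pre_galois_map (deform \<theta> G A) (twist_map (- \<theta>) (inv (pre_galois_map A) u)) = u" for u
      by (simp add: pre_galois_deform twist_map_minus' surj_f_inv_f[OF surj])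
  qed
  moreover have "t \<in> cv.span (balanced_relators (deform \<theta> G A) (coinvariants H A))"
    if "pre_galois_map (deform \<theta> G A) t = 0" for t
    using twist_map_relators[OF kernel, of "twist_map \<theta> t" \<theta>] that
    by (simp add: pre_galois_deform twist_map_minus)
  ultimately show ?thesis
    using bij_galois_map_iff[OF hopf comodule_algebra_deform, of \<theta>]
    by (simp add: hopf_galois_extension_def comodule_algebra_deform)
qed

end


section \<open>Deformed Hopf--Galois extensions\<close>

theorem proposition4p2:
  fixes H :: "'h::complex_vector hopf"
    and A :: "('a::complex_vector, 'h) comodule"
    and G :: "int ^ 'n \<Rightarrow> 'a set"
    and \<theta> :: "real ^ 'n ^ 'n"
  assumes "hopf_algebra H"
    and "comodule_algebra H A"
    and "graded_algebra A G"
    and "\<And>r. coaction A ` G r \<subseteq> tensor_subspace (G r) UNIV"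
    and "transpose \<theta> = - \<theta>"
  shows "(comodule_algebra H (deform \<theta> G A) \<and> coaction (deform \<theta> G A) = coaction A) \<and>
    (coinvariants H (deform \<theta> G A) = coinvariants H A \<and>
      subalgebra (deform \<theta> G A) (coinvariants H A)) \<and>
    (hopf_galois_extension H (coinvariants H A) A \<longrightarrow>
      hopf_galois_extension H (coinvariants H A) (deform \<theta> G A))"
proof -
  interpret graded_comodule_alg A G H
    using assms(1-4) by unfold_locales
  have "comodule_algebra H (deform \<theta> G A)"
    by (rule comodule_algebra_deform)
  moreover from this have "subalgebra (deform \<theta> G A) (coinvariants H A)"
    using subalgebra_coinvariants[OF assms(1)] coinvariants_deform by metis
  ultimately show ?thesis
    using hopf_galois_deform by simp
qed

end
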